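(* Let $(T,+,\Gamma)$ be a commutative ternary $\Gamma$-semiring and let $P$ be a proper ideal of $T$. The following statements are equivalent: (a) $P$ is prime; (b) the quotient $T/P$ has no nonzero zero-divisors, i.e. for all $a,b,c\in T/P$ and $\alpha,\beta\in\Gamma$, $a_{\alpha}b_{\beta}c=0$ in $T/P$ implies $a=0$ or $b=0$ or $c=0$ in $T/P$.
   Context: A ternary $\Gamma$-semiring $(T,+,\Gamma)$ consists of a set $T$, an addition $+$, a set $\Gamma$ of parameters, and a map $T\times\Gamma\times T\times\Gamma\times T\to T$, $(a,\alpha,b,\beta,c)\mapsto a_{\alpha}b_{\beta}c$, such that: $(T,+)$ is a commutative semigroup with identity element $0$; $(a_{\alpha}b_{\beta}c)_{\gamma}d_{\delta}e=a_{\alpha}b_{\beta}(c_{\gamma}d_{\delta}e)$; the product is additive in each of its three $T$-variables; and $0_{\alpha}b_{\beta}c=a_{\alpha}0_{\beta}c=a_{\alpha}b_{\beta}0=0$. It is commutative if $a_{\alpha}b_{\beta}c=b_{\beta}a_{\alpha}c=c_{\alpha}b_{\beta}a$ for all $a,b,c\in T$, $\alpha,\beta\in\Gamma$. An ideal is a nonempty $I\subseteq T$ closed under $+$ such that $a_{\alpha}b_{\beta}c\in I$ whenever at least one of $a,b,c\in T$ lies in $I$ (all $\alpha,\beta\in\Gamma$); it is proper if $I\ne T$. A proper ideal $P$ is prime if for all $a,b,c\in T$, $\alpha,\beta\in\Gamma$: $a_{\alpha}b_{\beta}c\in P$ implies $a\in P$ or $b\in P$ or $c\in P$. For an ideal $I$,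 $T/I$ is the quotient of $T$ by the relation $a\equiv b\pmod I\iff a-b\in I$, which is taken to be a congruence (for both addition and the ternary product), with the induced operations $[a]+[b]=[a+b]$, $[a]_{\alpha}[b]_{\beta}[c]=[a_{\alpha}b_{\beta}c]$ and zero element $[0]$; in particular $[a]=[0]$ if and only if $a\in I$. *)

theory Defs
  imports "HOL-Algebra.Group"
begin

record ('a, 'g) tgs = "'a partial_object" +
  tadd :: "'a \<Rightarrow> 'a \<Rightarrow> 'a"
  tzero :: 'a
  params :: "'g set"
  tprod :: "'a \<Rightarrow> 'g \<Rightarrow> 'a \<Rightarrow> 'g \<Rightarrow> 'a \<Rightarrow> 'a"

locale ternary_gamma_semiring =
  fixes S :: "('a, 'g) tgs"
  assumes additive_monoid:
    "comm_monoid \<lparr>carrier = carrier S, mult = tadd S, one = tzero S\<rparr>"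
  and tprod_closed:
    "\<lbrakk>a \<in> carrier S; b \<in> carrier S; c \<in> carrier S; \<alpha> \<in> params S; \<beta> \<in> params S\<rbrakk>
      \<Longrightarrow> tprod S a \<alpha> b \<beta> c \<in> carrier S"
  and tprod_assoc:
    "\<lbrakk>a \<in> carrier S; b \<in> carrier S; c \<in> carrier S; d \<in> carrier S; e \<in> carrier S;
      \<alpha> \<in> params S; \<beta> \<in> params S; \<gamma> \<in> params S; \<delta> \<in> params S\<rbrakk>
      \<Longrightarrow> tprod S (tprod S a \<alpha> b \<beta> c) \<gamma> d \<delta> e = tprod S a \<alpha> b \<beta> (tprod S c \<gamma> d \<delta> e)"
  and tprod_add1:
    "\<lbrakk>a \<in> carrier S; a' \<in> carrier S; b \<in> carrier S; c \<in> carrier S; \<alpha> \<in> params S; \<beta> \<in> params S\<rbrakk>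
      \<Longrightarrow> tprod S (tadd S a a') \<alpha> b \<beta> c = tadd S (tprod S a \<alpha> b \<beta> c) (tprod S a' \<alpha> b \<beta> c)"
  and tprod_add2:
    "\<lbrakk>a \<in> carrier S; b \<in> carrier S; b' \<in> carrier S; c \<in> carrier S; \<alpha> \<in> params S; \<beta> \<in> params S\<rbrakk>
      \<Longrightarrow> tprod S a \<alpha> (tadd S b b') \<beta> c = tadd S (tprod S a \<alpha> b \<beta> c) (tprod S a \<alpha> b' \<beta> c)"
  and tprod_add3:
    "\<lbrakk>a \<in> carrier S; b \<in> carrier S; c \<in> carrier S; c' \<in> carrier S; \<alpha> \<in> params S; \<beta> \<in> params S\<rbrakk>
      \<Longrightarrow> tprod S a \<alpha> b \<beta> (tadd S c c') = tadd S (tprod S a \<alpha> b \<beta> c) (tprod S a \<alpha> b \<beta> c')"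
  and tprod_zero:
    "\<lbrakk>b \<in> carrier S; c \<in> carrier S; \<alpha> \<in> params S; \<beta> \<in> params S\<rbrakk>
      \<Longrightarrow> tprod S (tzero S) \<alpha> b \<beta> c = tzero S"
    "\<lbrakk>a \<in> carrier S; c \<in> carrier S; \<alpha> \<in> params S; \<beta> \<in> params S\<rbrakk>
      \<Longrightarrow> tprod S a \<alpha> (tzero S) \<beta> c = tzero S"
    "\<lbrakk>a \<in> carrier S; b \<in> carrier S; \<alpha> \<in> params S; \<beta> \<in> params S\<rbrakk>
      \<Longrightarrow> tprod S a \<alpha> b \<beta> (tzero S) = tzero S"

locale comm_ternary_gamma_semiring = ternary_gamma_semiring +
  assumes tprod_comm:
    "\<lbrakk>a \<in> carrier S; b \<in> carrier S; c \<in> carrier S; \<alpha> \<in> params S; \<beta> \<in> params S\<rbrakk>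
      \<Longrightarrow> tprod S a \<alpha> b \<beta> c = tprod S b \<alpha> a \<beta> c"
    "\<lbrakk>a \<in> carrier S; b \<in> carrier S; c \<in> carrier S; \<alpha> \<in> params S; \<beta> \<in> params S\<rbrakk>
      \<Longrightarrow> tprod S a \<alpha> b \<beta> c = tprod S c \<alpha> b \<beta> a"

definition tg_ideal :: "('a, 'g) tgs \<Rightarrow> 'a set \<Rightarrow> bool" where
  "tg_ideal S I \<longleftrightarrow>
    I \<noteq> {} \<and> I \<subseteq> carrier S \<and>
    (\<forall>a\<in>I. \<forall>b\<in>I. tadd S a b \<in> I) \<and>
    (\<forall>a\<in>carrier S. \<forall>b\<in>carrier S. \<forall>c\<in>carrier S. \<forall>\<alpha>\<in>params S. \<forall>\<beta>\<in>params S.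
      a \<in> I \<or> b \<in> I \<or> c \<in> I \<longrightarrow> tprod S a \<alpha> b \<beta> c \<in> I)"

definition tg_proper_ideal :: "('a, 'g) tgs \<Rightarrow> 'a set \<Rightarrow> bool" where
  "tg_proper_ideal S I \<longleftrightarrow> tg_ideal S I \<and> I \<noteq> carrier S"

definition tg_prime_ideal :: "('a, 'g) tgs \<Rightarrow> 'a set \<Rightarrow> bool" where
  "tg_prime_ideal S P \<longleftrightarrow>
    tg_proper_ideal S P \<and>
    (\<forall>a\<in>carrier S. \<forall>b\<in>carrier S. \<forall>c\<in>carrier S. \<forall>\<alpha>\<in>params S. \<forall>\<beta>\<in>params S.
      tprod S a \<alpha> b \<beta> c \<in> P \<longrightarrow> a \<in> P \<or> b \<in> P \<or> c \<in> P)"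

text \<open>
  A semiring has no subtraction, so ``\<open>a - b\<close> lies in \<open>I\<close>'' is rendered in the standard
  subtraction-free way (the Bourne relation): \<open>a + i = b + j\<close> for some \<open>i, j\<close> in \<open>I\<close>.
  For every ideal this is a congruence. It contains the one-sided relation
  ``\<open>a = b + d\<close> for some \<open>d\<close> in \<open>I\<close>'', and coincides with it whenever the latter is symmetric
  (lemma \<open>difference_rel_eq_tg_cong\<close>).
  The zero class always contains \<open>I\<close>, provided \<open>0\<close> lies in \<open>I\<close>, but may be larger; that it
  equals \<open>I\<close> is therefore a genuine condition, to be assumed wherever it is used.
\<close>
definition tg_cong :: "('a, 'g) tgs \<Rightarrow> 'a set \<Rightarrow> ('a \<times> 'a) set" where
  "tg_cong S I = {(a, b). a \<in> carrier S \<and> b \<in> carrier S \<and>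
    (\<exists>i\<in>I. \<exists>j\<in>I. tadd S a i = tadd S b j)}"

definition tg_class :: "('a, 'g) tgs \<Rightarrow> 'a set \<Rightarrow> 'a \<Rightarrow> 'a set" where
  "tg_class S I a = tg_cong S I `` {a}"

text \<open>
  The operations are defined by unions over all representatives; by \<open>tadd_tg_quot\<close> and
  \<open>tprod_tg_quot\<close> they are the induced operations on classes.
\<close>
definition tg_quot :: "('a, 'g) tgs \<Rightarrow> 'a set \<Rightarrow> ('a set, 'g) tgs" where
  "tg_quot S I = \<lparr>
    carrier = carrier S // tg_cong S I,
    tadd = (\<lambda>X Y. \<Union>x\<in>X. \<Union>y\<in>Y. tg_class S I (tadd S x y)),
    tzero = tg_class S I (tzero S),
    params = params S,
    tprod = (\<lambda>X \<alpha> Y \<beta> Z. \<Union>x\<in>X. \<Union>y\<in>Y. \<Union>z\<in>Z. tg_class S I (tprod S x \<alpha> y \<beta> z))\<rparr>"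

definition no_nonzero_zero_divisors :: "('a, 'g) tgs \<Rightarrow> bool" where
  "no_nonzero_zero_divisors S \<longleftrightarrow>
    (\<forall>a\<in>carrier S. \<forall>b\<in>carrier S. \<forall>c\<in>carrier S. \<forall>\<alpha>\<in>params S. \<forall>\<beta>\<in>params S.
      tprod S a \<alpha> b \<beta> c = tzero S \<longrightarrow> a = tzero S \<or> b = tzero S \<or> c = tzero S)"

context ternary_gamma_semiring
begin

lemma tadd_closed [simp]:
    "a \<in> carrier S \<Longrightarrow> b \<in> carrier S \<Longrightarrow> tadd S a b \<in> carrier S"
  and tzero_closed [simp]: "tzero S \<in> carrier S"
  and tadd_assoc: "a \<in> carrier S \<Longrightarrow> b \<in> carrier S \<Longrightarrow> c \<in> carrier S \<Longrightarrow>
    tadd S (tadd S a b) c = tadd S a (tadd S b c)"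
  and tadd_comm: "a \<in> carrier S \<Longrightarrow> b \<in> carrier S \<Longrightarrow> tadd S a b = tadd S b a"
  and tadd_tzero [simp]: "a \<in> carrier S \<Longrightarrow> tadd S a (tzero S) = a"
proof -
  interpret M: comm_monoid "\<lparr>carrier = carrier S, mult = tadd S, one = tzero S\<rparr>"
    by (rule additive_monoid)
  show "a \<in> carrier S \<Longrightarrow> b \<in> carrier S \<Longrightarrow> tadd S a b \<in> carrier S"
    using M.m_closed by simp
  show "tzero S \<in> carrier S" using M.one_closed by simp
  show "a \<in> carrier S \<Longrightarrow> b \<in> carrier S \<Longrightarrow> c \<in> carrier S \<Longrightarrow>
    tadd S (tadd S a b) c = tadd S a (tadd S b c)" using M.m_assoc by simp
  show "a \<in> carrier S \<Longrightarrow> b \<in> carrier S \<Longrightarrow> tadd S a b = tadd S b a"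
    using M.m_comm by simp
  show "a \<in> carrier S \<Longrightarrow> tadd S a (tzero S) = a" using M.r_one by simp
qed

lemma tadd_left_comm: "a \<in> carrier S \<Longrightarrow> b \<in> carrier S \<Longrightarrow> c \<in> carrier S \<Longrightarrow>
    tadd S a (tadd S b c) = tadd S b (tadd S a c)"
  by (metis tadd_assoc tadd_comm)

lemmas tadd_ac = tadd_assoc tadd_comm tadd_left_comm

lemma tg_congI:
  "\<lbrakk>tadd S a i = tadd S b j; i \<in> I; j \<in> I; a \<in> carrier S; b \<in> carrier S\<rbrakk>
    \<Longrightarrow> (a, b) \<in> tg_cong S I"
  by (auto simp: tg_cong_def)

lemma equiv_tg_cong:
  assumes "tg_ideal S I"
  shows "equiv (carrier S) (tg_cong S I)"
proof (rule equivI)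
  have I: "I \<noteq> {}" "\<And>i. i \<in> I \<Longrightarrow> i \<in> carrier S"
      "\<And>i j. i \<in> I \<Longrightarrow> j \<in> I \<Longrightarrow> tadd S i j \<in> I"
    using assms by (auto simp: tg_ideal_def)
  show "tg_cong S I \<subseteq> carrier S \<times> carrier S" by (auto simp: tg_cong_def)
  show "refl_on (carrier S) (tg_cong S I)" using I(1) by (auto simp: refl_on_def tg_cong_def)
  show "sym (tg_cong S I)" by (auto simp: sym_def tg_cong_def) metis
  show "trans (tg_cong S I)"
  proof (rule transI)
    fix a b c assume "(a, b) \<in> tg_cong S I" "(b, c) \<in> tg_cong S I"
    then obtain i j k l where h: "a \<in> carrier S" "b \<in> carrier S" "c \<in> carrier S"
        "i \<in> I" "j \<in> I" "k \<in> I" "l \<in> I" "tadd S a i = tadd S b j" "tadd S b k = tadd S c l"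
      by (auto simp: tg_cong_def)
    have "tadd S a (tadd S i k) = tadd S (tadd S b j) k"
      using h I(2) by (metis tadd_assoc)
    also have "\<dots> = tadd S (tadd S b k) j"
      using h(1-7) I(2) by (simp add: tadd_ac)
    also have "\<dots> = tadd S (tadd S c l) j"
      by (simp only: h(9))
    also have "\<dots> = tadd S c (tadd S l j)"
      using h(1-7) I(2) by (simp add: tadd_assoc)
    finally show "(a, c) \<in> tg_cong S I" using h I(3) by (auto simp: tg_cong_def)
  qed
qed

lemma tg_cong_tadd:
  assumes "tg_ideal S I" "(a, a') \<in> tg_cong S I" "(b, b') \<in> tg_cong S I"
  shows "(tadd S a b, tadd S a' b') \<in> tg_cong S I"
proof -
  have I: "\<And>i. i \<in> I \<Longrightarrow> i \<in> carrier S" "\<And>i j. i \<in> I \<Longrightarrow> j \<in> I \<Longrightarrow> tadd S i j \<in> I"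
    using assms(1) by (auto simp: tg_ideal_def)
  obtain i j k l where h: "a \<in> carrier S" "a' \<in> carrier S" "b \<in> carrier S" "b' \<in> carrier S"
      "i \<in> I" "j \<in> I" "k \<in> I" "l \<in> I" "tadd S a i = tadd S a' j" "tadd S b k = tadd S b' l"
    using assms(2,3) by (auto simp: tg_cong_def)
  have "tadd S (tadd S a b) (tadd S i k) = tadd S (tadd S a i) (tadd S b k)"
    using h(1-8) I(1) by (simp add: tadd_ac)
  also have "\<dots> = tadd S (tadd S a' j) (tadd S b' l)" by (simp only: h(9,10))
  also have "\<dots> = tadd S (tadd S a' b') (tadd S j l)"
    using h(1-8) I(1) by (simp add: tadd_ac)
  finally have "\<exists>u\<in>I. \<exists>v\<in>I. tadd S (tadd S a b) u = tadd S (tadd S a' b') v"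
    using h(5-8) I(2) by blast
  then show ?thesis using h(1-4) by (simp add: tg_cong_def)
qed

lemma tg_cong_tprod:
  assumes "tg_ideal S I" "(a, a') \<in> tg_cong S I" "(b, b') \<in> tg_cong S I" "(c, c') \<in> tg_cong S I"
    and g: "\<alpha> \<in> params S" "\<beta> \<in> params S"
  shows "(tprod S a \<alpha> b \<beta> c, tprod S a' \<alpha> b' \<beta> c') \<in> tg_cong S I"
proof -
  have I: "\<And>i. i \<in> I \<Longrightarrow> i \<in> carrier S"
    "\<And>a b c. \<lbrakk>a \<in> carrier S; b \<in> carrier S; c \<in> carrier S; a \<in> I \<or> b \<in> I \<or> c \<in> I\<rbrakk>
      \<Longrightarrow> tprod S a \<alpha> b \<beta> c \<in> I"
    using assms(1) g unfolding tg_ideal_def by blast+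
  have car: "a \<in> carrier S" "a' \<in> carrier S" "b \<in> carrier S" "b' \<in> carrier S"
      "c \<in> carrier S" "c' \<in> carrier S"
    using assms by (auto simp: tg_cong_def)
  obtain i j where 1: "i \<in> I" "j \<in> I" "tadd S a i = tadd S a' j"
    using assms by (auto simp: tg_cong_def)
  obtain k l where 2: "k \<in> I" "l \<in> I" "tadd S b k = tadd S b' l"
    using assms by (auto simp: tg_cong_def)
  obtain m n where 3: "m \<in> I" "n \<in> I" "tadd S c m = tadd S c' n"
    using assms by (auto simp: tg_cong_def)
  have "(tprod S a \<alpha> b \<beta> c, tprod S a' \<alpha> b \<beta> c) \<in> tg_cong S I"
  proof (rule tg_congI)
    show "tadd S (tprod S a \<alpha> b \<beta> c) (tprod S i \<alpha> b \<beta> c) = tadd S (tprod S a' \<alpha> b \<beta> c) (tprod S j \<alpha> b \<beta> c)"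
      using arg_cong[OF 1(3), of "\<lambda>x. tprod S x \<alpha> b \<beta> c"] 1(1,2) car g I(1)
      by (simp add: tprod_add1)
  qed (use 1(1,2) car g I in \<open>simp_all add: tprod_closed\<close>)
  moreover have "(tprod S a' \<alpha> b \<beta> c, tprod S a' \<alpha> b' \<beta> c) \<in> tg_cong S I"
  proof (rule tg_congI)
    show "tadd S (tprod S a' \<alpha> b \<beta> c) (tprod S a' \<alpha> k \<beta> c) = tadd S (tprod S a' \<alpha> b' \<beta> c) (tprod S a' \<alpha> l \<beta> c)"
      using arg_cong[OF 2(3), of "\<lambda>x. tprod S a' \<alpha> x \<beta> c"] 2(1,2) car g I(1)
      by (simp add: tprod_add2)
  qed (use 2(1,2) car g I in \<open>simp_all add: tprod_closed\<close>)
  moreover have "(tprod S a' \<alpha> b' \<beta> c, tprod S a' \<alpha> b' \<beta> c') \<in> tg_cong S I"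
  proof (rule tg_congI)
    show "tadd S (tprod S a' \<alpha> b' \<beta> c) (tprod S a' \<alpha> b' \<beta> m) = tadd S (tprod S a' \<alpha> b' \<beta> c') (tprod S a' \<alpha> b' \<beta> n)"
      using arg_cong[OF 3(3), of "\<lambda>x. tprod S a' \<alpha> b' \<beta> x"] 3(1,2) car g I(1)
      by (simp add: tprod_add3)
  qed (use 3(1,2) car g I in \<open>simp_all add: tprod_closed\<close>)
  ultimately show ?thesis
    using equiv_tg_cong[OF assms(1)] by (meson equivE transE)
qed

lemma tadd_tg_quot:
  assumes I: "tg_ideal S I" and "a \<in> carrier S" "b \<in> carrier S"
  shows "tadd (tg_quot S I) (tg_class S I a) (tg_class S I b) = tg_class S I (tadd S a b)"
proof -
  note E = equiv_tg_cong[OF I]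
  have eq: "tg_class S I (tadd S x y) = tg_class S I (tadd S a b)"
    if "x \<in> tg_class S I a" "y \<in> tg_class S I b" for x y
    using that equiv_class_eq[OF E tg_cong_tadd[OF I]] by (simp add: tg_class_def)
  have mem: "a \<in> tg_class S I a" "b \<in> tg_class S I b"
    using equiv_class_self[OF E] assms(2,3) by (auto simp: tg_class_def)
  have "(\<Union>x\<in>tg_class S I a. \<Union>y\<in>tg_class S I b. tg_class S I (tadd S x y))
      = (\<Union>x\<in>tg_class S I a. \<Union>y\<in>tg_class S I b. tg_class S I (tadd S a b))"
    by (intro SUP_cong refl eq)
  also have "\<dots> = tg_class S I (tadd S a b)"
    using mem by blast
  finally show ?thesis by (simp add: tg_quot_def)
qed

lemma tprod_tg_quot:
  assumes I: "tg_ideal S I" and "a \<in> carrier S" "b \<in> carrier S" "c \<in> carrier S"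
    and g: "\<alpha> \<in> params S" "\<beta> \<in> params S"
  shows "tprod (tg_quot S I) (tg_class S I a) \<alpha> (tg_class S I b) \<beta> (tg_class S I c)
    = tg_class S I (tprod S a \<alpha> b \<beta> c)"
proof -
  note E = equiv_tg_cong[OF I]
  have eq: "tg_class S I (tprod S x \<alpha> y \<beta> z) = tg_class S I (tprod S a \<alpha> b \<beta> c)"
    if "x \<in> tg_class S I a" "y \<in> tg_class S I b" "z \<in> tg_class S I c" for x y z
    using that equiv_class_eq[OF E tg_cong_tprod[OF I _ _ _ g]] by (simp add: tg_class_def)
  have mem: "a \<in> tg_class S I a" "b \<in> tg_class S I b" "c \<in> tg_class S I c"
    using equiv_class_self[OF E] assms(2-4) by (auto simp: tg_class_def)
  have "(\<Union>x\<in>tg_class S I a. \<Union>y\<in>tg_class S I b. \<Union>z\<in>tg_class S I c. tg_class S I (tprod S x \<alpha> y \<beta> z))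
      = (\<Union>x\<in>tg_class S I a. \<Union>y\<in>tg_class S I b. \<Union>z\<in>tg_class S I c. tg_class S I (tprod S a \<alpha> b \<beta> c))"
    by (intro SUP_cong refl eq)
  also have "\<dots> = tg_class S I (tprod S a \<alpha> b \<beta> c)"
    using mem by blast
  finally show ?thesis by (simp add: tg_quot_def)
qed

lemma difference_rel_eq_tg_cong:
  assumes I: "tg_ideal S I"
    and D: "D = {(a, b). a \<in> carrier S \<and> b \<in> carrier S \<and> (\<exists>d\<in>I. a = tadd S b d)}"
    and "sym D"
  shows "D = tg_cong S I"
proof
  have Ic: "\<And>i. i \<in> I \<Longrightarrow> i \<in> carrier S" "\<And>i j. i \<in> I \<Longrightarrow> j \<in> I \<Longrightarrow> tadd S i j \<in> I" "I \<noteq> {}"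
    using I by (auto simp: tg_ideal_def)
  show "D \<subseteq> tg_cong S I"
  proof clarify
    fix a b assume "(a, b) \<in> D"
    then obtain d where d: "a \<in> carrier S" "b \<in> carrier S" "d \<in> I" "a = tadd S b d"
      by (auto simp: D)
    obtain i where "i \<in> I" using Ic(3) by auto
    then have "tadd S a i = tadd S b (tadd S d i)" "tadd S d i \<in> I"
      using d Ic by (auto simp: tadd_assoc)
    then show "(a, b) \<in> tg_cong S I" using d \<open>i \<in> I\<close> by (auto simp: tg_cong_def)
  qed
  show "tg_cong S I \<subseteq> D"
  proof clarify
    fix a b assume "(a, b) \<in> tg_cong S I"
    then obtain i j where h: "a \<in> carrier S" "b \<in> carrier S" "i \<in> I" "j \<in> I"
        "tadd S a i = tadd S b j" by (auto simp: tg_cong_def)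
    have "(tadd S a i, a) \<in> D" using h(1-4) Ic by (auto simp: D)
    then have "(a, tadd S a i) \<in> D" using \<open>sym D\<close> by (meson symD)
    then obtain d where d: "d \<in> I" "a = tadd S (tadd S a i) d" by (auto simp: D)
    then have "a = tadd S b (tadd S j d)" using h(1-4) Ic(1) by (metis h(5) tadd_assoc)
    moreover have "tadd S j d \<in> I" using h(4) d(1) Ic(2) by blast
    ultimately show "(a, b) \<in> D" using h(1,2) unfolding D by blast
  qed
qed

end

end

theory Submission imports Defs begin

text \<open>Every element of the quotient is a class \<open>[a]\<close>, and a product of classes is
  the class of the product (\<open>tprod_tg_quot\<close>). As \<open>[a] = [0]\<close> exactly when
  \<open>a\<close> lies in \<open>P\<close>, the absence of zero-divisors, read on representatives,
  is the elementwise condition of primeness. \<open>no_nonzero_zero_divisors_tg_quot_iff\<close>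
  carries out this translation.\<close>

lemma carrier_tg_quot: "carrier (tg_quot S I) = tg_class S I ` carrier S"
  by (auto simp: tg_quot_def tg_class_def quotient_def)

text \<open>The right-hand side is what \<open>tg_prime_ideal\<close> demands beyond
  properness.\<close>

lemma (in ternary_gamma_semiring) no_nonzero_zero_divisors_tg_quot_iff:
  assumes I: "tg_ideal S I"
    and zero_class: "\<forall>a\<in>carrier S. tg_class S I a = tg_class S I (tzero S) \<longleftrightarrow> a \<in> I"
  shows "no_nonzero_zero_divisors (tg_quot S I) \<longleftrightarrow>
    (\<forall>a\<in>carrier S. \<forall>b\<in>carrier S. \<forall>c\<in>carrier S. \<forall>\<alpha>\<in>params S. \<forall>\<beta>\<in>params S.
      tprod S a \<alpha> b \<beta> c \<in> I \<longrightarrow> a \<in> I \<or> b \<in> I \<or> c \<in> I)"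
proof -
  have "tzero (tg_quot S I) = tg_class S I (tzero S)" "params (tg_quot S I) = params S"
    by (simp_all add: tg_quot_def)
  \<comment> \<open>\<open>carrier_tg_quot\<close> turns quantifiers over classes into quantifiers
    over representatives; \<open>tprod_closed\<close> lets \<open>zero_class\<close> be applied to
    the product.\<close>
  then show ?thesis
    using zero_class
    by (simp add: no_nonzero_zero_divisors_def carrier_tg_quot tprod_tg_quot[OF I] tprod_closed)
qed

theorem theorem3p4:
  fixes S :: "('a, 'g) tgs" and P :: "'a set"
  assumes "comm_ternary_gamma_semiring S"
    and "tg_proper_ideal S P"
    and zero_class: "\<forall>a\<in>carrier S. tg_class S P a = tg_class S P (tzero S) \<longleftrightarrow> a \<in> P"
  shows "tg_prime_ideal S P \<longleftrightarrow> no_nonzero_zero_divisors (tg_quot S P)"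
proof -
  interpret comm_ternary_gamma_semiring S by fact
  have "tg_ideal S P"
    using assms(2) by (simp add: tg_proper_ideal_def)
  then show ?thesis
    using assms(2) no_nonzero_zero_divisors_tg_quot_iff[OF _ zero_class]
    by (simp add: tg_prime_ideal_def)
qed

end
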